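(* For all integers $k\ge0$ and $n\ge1$, \[ f_{121,212}(n,k)=\sum_{j=0}^{k} j!\binom{k}{j}\binom{n-1}{j-1}, \] and $f_{121,212}(0,k)=1$ for all $k\ge0$.
   Context: For integers $k,n\ge 0$, a word is an element of $[k]^n$, where $[k]=\{1,\dots,k\}$ is totally ordered. A pattern is a word $\tau\in[\ell]^m$ containing every letter $1,\dots,\ell$. A word $\sigma\in[k]^n$ contains $\tau$ if there are indices $1\le i_1<\dots<i_m\le n$ such that for all $1\le a,b\le m$ and each relation $\phi\in\{<,=,>\}$, $\sigma(i_a)\,\phi\,\sigma(i_b)$ holds iff $\tau(a)\,\phi\,\tau(b)$ holds; otherwise $\sigma$ avoids $\tau$. $f_{121,212}(n,k)$ is the number of words in $[k]^n$ that avoid both $121$ and $212$. Here $\binom{n-1}{-1}=0$. *)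

theory Defs
  imports Main
begin

definition words :: "nat \<Rightarrow> nat \<Rightarrow> nat list set" where
  "words n k = {w. length w = n \<and> set w \<subseteq> {1..k}}"

(* Positions are counted from 0, as usual for lists. Only the values of i below length \<tau> matter:
   they are the positions of the occurrence of \<tau> in \<sigma>. *)
definition contains_pattern :: "nat list \<Rightarrow> nat list \<Rightarrow> bool" where
  "contains_pattern \<sigma> \<tau> \<longleftrightarrow>
    (\<exists>i :: nat \<Rightarrow> nat.
       strict_mono_on {..<length \<tau>} i \<and>
       (\<forall>a < length \<tau>. i a < length \<sigma>) \<and>
       (\<forall>a < length \<tau>. \<forall>b < length \<tau>.
          (\<sigma> ! i a < \<sigma> ! i b \<longleftrightarrow> \<tau> ! a < \<tau> ! b) \<and>
          (\<sigma> ! i a = \<sigma> ! i b \<longleftrightarrow> \<tau> ! a = \<tau> ! b) \<and>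
          (\<sigma> ! i a > \<sigma> ! i b \<longleftrightarrow> \<tau> ! a > \<tau> ! b)))"

definition avoids :: "nat list \<Rightarrow> nat list \<Rightarrow> bool" where
  "avoids \<sigma> \<tau> \<longleftrightarrow> \<not> contains_pattern \<sigma> \<tau>"

definition num_avoiding :: "nat list set \<Rightarrow> nat \<Rightarrow> nat \<Rightarrow> nat" where
  "num_avoiding T n k = card {\<sigma> \<in> words n k. \<forall>\<tau>\<in>T. avoids \<sigma> \<tau>}"

(* Binomial coefficient with an integer lower index, zero if that index is negative. *)
definition binom :: "nat \<Rightarrow> int \<Rightarrow> nat" where
  "binom n j = (if j < 0 then 0 else n choose nat j)"

end

theory Submission
  imports Defs
begin

text \<open>
  A word avoids both 121 and 212 iff the occurrences of each letter are contiguous, that is, iff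
  collapsing each run to a single letter leaves a word with distinct letters. There are
  \<open>j! (k choose j)\<close> collapsed words of length \<open>j\<close>, and each of them arises from
  \<open>(n - 1) choose (j - 1)\<close> words of length \<open>n\<close>, the compositions of \<open>n\<close> into \<open>j\<close> run lengths.
\<close>

definition contiguous_letters :: "'a list \<Rightarrow> bool" where
  "contiguous_letters w \<longleftrightarrow>
    (\<forall>a b c. a < b \<and> b < c \<and> c < length w \<and> w ! a = w ! c \<longrightarrow> w ! b = w ! a)"

text \<open>The outer letters of the pattern agree, so beyond \<open>w ! a = w ! c\<close> only the
  comparison with the middle letter matters. Leaving \<open>x\<close> and \<open>y\<close> arbitrary
  serves both 121 and 212.\<close>

lemma contains_pattern_aba_iff:
  "contains_pattern w [x, y, x] \<longleftrightarrow>
    (\<exists>a b c. a < b \<and> b < c \<and> c < length w \<and> w ! a = w ! c \<and>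
       (w ! a < w ! b \<longleftrightarrow> x < y) \<and> (w ! b < w ! a \<longleftrightarrow> y < x))" (is "?L \<longleftrightarrow> ?R")
proof
  assume ?L
  then obtain i where i: "strict_mono_on {..<3} i" "\<forall>a<3. i a < length w"
    and rel: "\<forall>a<3. \<forall>b<3.
      (w ! i a < w ! i b \<longleftrightarrow> [x, y, x] ! a < [x, y, x] ! b) \<and>
      (w ! i a = w ! i b \<longleftrightarrow> [x, y, x] ! a = [x, y, x] ! b) \<and>
      (w ! i a > w ! i b \<longleftrightarrow> [x, y, x] ! a > [x, y, x] ! b)"
    unfolding contains_pattern_def by (auto simp: numeral_3_eq_3)
  have "i 0 < i 1" "i 1 < i 2"
    using i(1) by (auto intro: strict_mono_onD)
  moreover have "w ! i 0 = w ! i 2"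
    using rel[rule_format, of 0 2] by simp
  moreover have "w ! i 0 < w ! i 1 \<longleftrightarrow> x < y" "w ! i 1 < w ! i 0 \<longleftrightarrow> y < x"
    using rel[rule_format, of 0 1] by simp_all
  moreover have "i 2 < length w"
    using i(2) by simp
  ultimately show ?R by blast
next
  assume ?R
  then obtain a b c where *: "a < b" "b < c" "c < length w" "w ! a = w ! c"
    "w ! a < w ! b \<longleftrightarrow> x < y" "w ! b < w ! a \<longleftrightarrow> y < x" by blast
  let ?i = "\<lambda>m. [a, b, c] ! m"
  have all3: "(\<forall>m < length [x, y, x]. P m) \<longleftrightarrow> P 0 \<and> P 1 \<and> P 2" for P
    by (auto simp: less_Suc_eq numeral_2_eq_2)
  have "strict_mono_on {..<length [x, y, x]} ?i"
    using *(1,2) by (auto simp: strict_mono_on_def less_Suc_eq)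
  moreover have "\<forall>m < length [x, y, x]. ?i m < length w"
    unfolding all3 using *(1-3) by simp
  \<comment> \<open>Trichotomy recovers the equality clause from the two strict comparisons.\<close>
  moreover have "w ! a = w ! b \<longleftrightarrow> x = y"
    using *(5,6) by (metis linorder_neq_iff)
  then have "\<forall>p < length [x, y, x]. \<forall>q < length [x, y, x].
      (w ! ?i p < w ! ?i q \<longleftrightarrow> [x, y, x] ! p < [x, y, x] ! q) \<and>
      (w ! ?i p = w ! ?i q \<longleftrightarrow> [x, y, x] ! p = [x, y, x] ! q) \<and>
      (w ! ?i p > w ! ?i q \<longleftrightarrow> [x, y, x] ! p > [x, y, x] ! q)"
    unfolding all3 using *(5,6) by (simp add: *(4)[symmetric] eq_commute[of _ "w ! a"] eq_commute[of _ x])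
  ultimately show ?L
    unfolding contains_pattern_def by (intro exI[of _ ?i] conjI)
qed

text \<open>Contiguity fails when two equal letters enclose a different one: a larger enclosed
  letter gives 121, a smaller one 212.\<close>

lemma avoids_121_212_iff:
  "avoids w [1, 2, 1] \<and> avoids w [2, 1, 2] \<longleftrightarrow> contiguous_letters w"
proof -
  have "(p < q \<longleftrightarrow> (1::nat) < 2) \<and> (q < p \<longleftrightarrow> (2::nat) < 1) \<longleftrightarrow> p < q"
    and "(p < q \<longleftrightarrow> (2::nat) < 1) \<and> (q < p \<longleftrightarrow> (1::nat) < 2) \<longleftrightarrow> q < p" for p q :: nat
    by auto
  note contains = contains_pattern_aba_iff[of w 1 2, unfolded this]
    contains_pattern_aba_iff[of w 2 1, unfolded this]
  have "\<not> contiguous_letters w \<longleftrightarrow>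
      (\<exists>a b c. a < b \<and> b < c \<and> c < length w \<and> w ! a = w ! c \<and> (w ! b < w ! a \<or> w ! a < w ! b))"
    unfolding contiguous_letters_def nat_neq_iff[symmetric] by blast
  also have "\<dots> \<longleftrightarrow> contains_pattern w [1, 2, 1] \<or> contains_pattern w [2, 1, 2]"
    unfolding contains by blast
  finally show ?thesis
    unfolding avoids_def by blast
qed

text \<open>A prepended letter must extend the first run or be new. The two-letter form follows the
  recursion of \<open>remdups_adj\<close>.\<close>

lemma contiguous_letters_Cons_Cons:
  "contiguous_letters (x # y # v) \<longleftrightarrow>
    contiguous_letters (y # v) \<and> (x = y \<or> x \<notin> set (y # v))" (is "?L \<longleftrightarrow> ?R")
proof
  assume L: ?L
  have "contiguous_letters (y # v)"
    unfolding contiguous_letters_def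
  proof (intro allI impI)
    fix a b c
    assume "a < b \<and> b < c \<and> c < length (y # v) \<and> (y # v) ! a = (y # v) ! c"
    then show "(y # v) ! b = (y # v) ! a"
      using L[unfolded contiguous_letters_def, rule_format, of "Suc a" "Suc b" "Suc c"] by simp
  qed
  moreover have "x \<notin> set v" if "x \<noteq> y"
  proof
    assume "x \<in> set v"
    then obtain m where "m < length v" "v ! m = x"
      by (auto simp: in_set_conv_nth)
    \<comment> \<open>Positions 0, 1 and \<open>m + 2\<close> of the full word read
      \<open>x\<close>, \<open>y\<close>, \<open>x\<close>.\<close>
    then show False
      using that L[unfolded contiguous_letters_def, rule_format, of 0 1 "Suc (Suc m)"] by simp
  qed
  ultimately show ?R by auto
next
  assume R: ?R
  show ?L
    unfolding contiguous_letters_def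
  proof (intro allI impI)
    fix a b c
    assume *: "a < b \<and> b < c \<and> c < length (x # y # v) \<and> (x # y # v) ! a = (x # y # v) ! c"
    then obtain b' c' where bc: "b = Suc b'" "c = Suc c'"
      by (metis less_nat_zero_code old.nat.exhaust)
    have C: "(y # v) ! q = (y # v) ! p"
      if "p < q" "q < r" "r < length (y # v)" "(y # v) ! p = (y # v) ! r" for p q r
      using R that unfolding contiguous_letters_def by blast
    show "(x # y # v) ! b = (x # y # v) ! a"
    proof (cases a)
      case 0
      \<comment> \<open>The letter \<open>x\<close> recurs in the tail, which forces
        \<open>x = y\<close>; position 0 of the tail then stands in for \<open>a\<close>. If
        \<open>b' = 0\<close>, the middle letter is \<open>y\<close> itself.\<close>
      have "(y # v) ! c' \<in> set (y # v)"
        using * bc by (intro nth_mem) simp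
      then have "x = y"
        using R * 0 bc by auto
      then show ?thesis
        using C[of 0 b' c'] * 0 bc by (cases b') auto
    next
      case (Suc a')
      then show ?thesis
        using C[of a' b' c'] * bc by simp
    qed
  qed
qed

lemma contiguous_letters_iff_distinct_remdups_adj:
  "contiguous_letters w \<longleftrightarrow> distinct (remdups_adj w)"
proof (induction w rule: remdups_adj.induct)
  case (3 x y v)
  then show ?case by (auto simp: contiguous_letters_Cons_Cons)
qed (auto simp: contiguous_letters_def)

lemma finite_remdups_adj_vimage:
  "finite {w. length w = n \<and> remdups_adj w = u}"
  by (rule finite_subset[OF _ finite_lists_length_eq[of "set u" n]]) auto

text \<open>Pascal's rule: deleting the first letter leaves a word collapsing to
  \<open>x # u\<close> if the first run is longer than one, and to \<open>u\<close> otherwise. With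
  length \<open>Suc n\<close> and \<open>length u + 1\<close> runs, no subtraction occurs.\<close>

lemma card_remdups_adj_vimage:
  assumes "distinct_adj (x # u)"
  shows "card {w. length w = Suc n \<and> remdups_adj w = x # u} = n choose length u"
  using assms
proof (induction n arbitrary: x u)
  case 0
  have "{w. length w = Suc 0 \<and> remdups_adj w = x # u} = (if u = [] then {[x]} else {})"
    by (auto simp: length_Suc_conv)
  then show ?case by (simp only:) (cases u; simp)
next
  case (Suc n)
  let ?S = "\<lambda>u. {w. length w = Suc n \<and> remdups_adj w = u}"
  have "{w. length w = Suc (Suc n) \<and> remdups_adj w = x # u} = Cons x ` (?S (x # u) \<union> ?S u)"
    (is "?A = ?B")
  proof (intro set_eqI iffI)
    fix w assume "w \<in> ?A"
    then obtain a b v where w: "w = a # b # v" and v: "length v = n" "remdups_adj w = x # u"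
      by (auto simp: length_Suc_conv)
    have "a = x"
      using hd_remdups_adj[of w] v w by (simp del: hd_remdups_adj)
    then show "w \<in> ?B"
      using v w by (cases "a = b") auto
  next
    fix w assume "w \<in> ?B"
    then obtain b v where w: "w = x # b # v" and v: "length v = n"
      and "remdups_adj (b # v) = x # u \<or> remdups_adj (b # v) = u"
      by (auto simp: length_Suc_conv)
    then consider "remdups_adj (b # v) = x # u" | "remdups_adj (b # v) = u" by blast
    then show "w \<in> ?A"
    proof cases
      case 1
      then have "b = x"
        using hd_remdups_adj[of "b # v"] by (simp del: hd_remdups_adj)
      then show ?thesis using 1 w v by simp
    next
      case 2
      \<comment> \<open>Collapsing keeps the first letter, so \<open>b\<close> heads
        \<open>u\<close> and differs from its neighbour \<open>x\<close>; hence \<open>x\<close>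
        starts a new run.\<close>
      then have "u \<noteq> []" "hd u = b"
        using hd_remdups_adj[of "b # v"] by auto
      then have "x \<noteq> b"
        using Suc.prems by (auto simp: distinct_adj_Cons)
      then show ?thesis using 2 w v by simp
    qed
  qed
  then have "card ?A = card (?S (x # u) \<union> ?S u)"
    by (simp add: card_image)
  also have "\<dots> = card (?S (x # u)) + card (?S u)"
    by (intro card_Un_disjoint finite_remdups_adj_vimage) auto
  also have "card (?S (x # u)) = n choose length u"
    by (rule Suc.IH) (rule Suc.prems)
  \<comment> \<open>No nonempty word collapses to \<open>[]\<close>. The case split is needed
    because truncated subtraction would give \<open>n choose 0 = 1\<close> there.\<close>
  also have "card (?S u) = (if u = [] then 0 else n choose (length u - 1))"
  proof (cases u)
    case (Cons y u')
    then show ?thesis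
      using Suc.IH[of y u'] Suc.prems by simp
  qed auto
  finally show ?case
    by (cases u) auto
qed

lemma card_distinct_lists_length:
  assumes "finite A"
  shows "card {u. length u = j \<and> distinct u \<and> set u \<subseteq> A} = fact j * (card A choose j)"
proof (cases "j \<le> card A")
  case True
  \<comment> \<open>The number of injective words is a falling factorial, written as a quotient so
    that \<open>fact (card A - j)\<close> cancels.\<close>
  have "\<Prod>{card A - j + 1..card A} = fact (card A) div fact (card A - j)"
    using fact_div_fact[of "card A - j" "card A"] by simp
  also have "fact (card A) = fact (card A - j) * (fact j * (card A choose j))"
    using binomial_fact_lemma[OF True] by (simp add: ac_simps)
  finally show ?thesis
    using assms True by (simp add: card_lists_distinct_length_eq)
next
  case False
  \<comment> \<open>By pigeonhole no such list exists, and the binomial coefficient vanishes as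
    well.\<close>
  have "length u \<le> card A" if "distinct u" "set u \<subseteq> A" for u
    using that assms by (metis card_mono distinct_card)
  then have "{u. length u = j \<and> distinct u \<and> set u \<subseteq> A} = {}"
    using False by blast
  then show ?thesis
    using False by (simp only: card.empty) simp
qed

text \<open>Words are grouped by their collapsed word \<open>u\<close>, and these by length
  \<open>j\<close>, which is at most \<open>k\<close> because the letters of \<open>u\<close> are
  distinct.\<close>

lemma num_avoiding_121_212_eq:
  "num_avoiding {[1, 2, 1], [2, 1, 2]} n k =
    (\<Sum>j = 0..k. \<Sum>u | length u = j \<and> distinct u \<and> set u \<subseteq> {1..k}.
      card {w. length w = n \<and> remdups_adj w = u})"
proof -
  let ?D = "\<lambda>j. {u. length u = j \<and> distinct u \<and> set u \<subseteq> {1..k}}"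
  let ?S = "\<lambda>u. {w. length w = n \<and> remdups_adj w = u}"
  have fin: "finite (?D j)" for j
    by (rule finite_subset[OF _ finite_lists_length_eq[of "{1..k}" j]]) auto
  have le: "length u \<le> k" if "distinct u" "set u \<subseteq> {1..k}" for u :: "nat list"
    using card_mono[OF _ that(2)] distinct_card[OF that(1)] by simp
  have "{w \<in> words n k. \<forall>\<tau>\<in>{[1, 2, 1], [2, 1, 2]}. avoids w \<tau>} =
      {w \<in> words n k. distinct (remdups_adj w)}"
    using avoids_121_212_iff contiguous_letters_iff_distinct_remdups_adj by auto
  \<comment> \<open>Collapsing preserves the set of letters, so the alphabet condition passes from
    \<open>w\<close> to \<open>u\<close>.\<close>
  also have "\<dots> = (\<Union>j\<in>{0..k}. \<Union>u\<in>?D j. ?S u)"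
    using le by (auto simp: words_def)
  finally have "num_avoiding {[1, 2, 1], [2, 1, 2]} n k = card (\<Union>j\<in>{0..k}. \<Union>u\<in>?D j. ?S u)"
    by (simp add: num_avoiding_def)
  also have "\<dots> = (\<Sum>j = 0..k. card (\<Union>u\<in>?D j. ?S u))"
    by (rule card_UN_disjoint) (use fin in \<open>auto intro: finite_remdups_adj_vimage\<close>)
  also have "\<dots> = (\<Sum>j = 0..k. \<Sum>u\<in>?D j. card (?S u))"
    using fin by (intro sum.cong refl card_UN_disjoint) (auto intro: finite_remdups_adj_vimage)
  finally show ?thesis .
qed

theorem theorem10:
  shows "(\<forall>k n :: nat. n \<ge> 1 \<longrightarrow>
            num_avoiding {[1, 2, 1], [2, 1, 2]} n k =
              (\<Sum>j = 0..k. fact j * (k choose j) * binom (n - 1) (int j - 1)))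
         \<and> (\<forall>k :: nat. num_avoiding {[1, 2, 1], [2, 1, 2]} 0 k = 1)"
proof (intro conjI allI impI)
  fix k n :: nat
  assume "n \<ge> 1"
  then obtain m where n: "n = Suc m" by (cases n) auto
  \<comment> \<open>For \<open>u = []\<close> the lower index is -1, and the value 0 of
    \<open>binom\<close> matches the absence of nonempty words collapsing to
    \<open>[]\<close>.\<close>
  have runs: "card {w. length w = n \<and> remdups_adj w = u} = binom (n - 1) (int (length u) - 1)"
    if "distinct u" for u :: "nat list"
  proof (cases u)
    case Nil
    then show ?thesis by (auto simp: binom_def n)
  next
    case (Cons x v)
    then show ?thesis
      using card_remdups_adj_vimage[of x v m] that distinct_adj_altdef[of u] remdups_adj_distinct[of u]
      by (simp add: binom_def n)
  qed
  \<comment> \<open>The summand depends on \<open>u\<close> only through its length, so the inner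
    sum becomes a multiple of the number of collapsed words.\<close>
  have "num_avoiding {[1, 2, 1], [2, 1, 2]} n k =
    (\<Sum>j = 0..k. \<Sum>u | length u = j \<and> distinct u \<and> set u \<subseteq> {1..k}. binom (n - 1) (int j - 1))"
    unfolding num_avoiding_121_212_eq by (intro sum.cong refl) (auto simp: runs)
  then show "num_avoiding {[1, 2, 1], [2, 1, 2]} n k =
      (\<Sum>j = 0..k. fact j * (k choose j) * binom (n - 1) (int j - 1))"
    by (simp add: card_distinct_lists_length)
next
  fix k :: nat
  have "{w \<in> words 0 k. \<forall>\<tau>\<in>{[1, 2, 1], [2, 1, 2]}. avoids w \<tau>} = {[]}"
    using avoids_121_212_iff[of "[]"] by (auto simp: words_def contiguous_letters_def)
  then show "num_avoiding {[1, 2, 1], [2, 1, 2]} 0 k = 1"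
    by (simp add: num_avoiding_def)
qed

end
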